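(* Let $(X,\mathcal{B})$ be a primitive uniform space, and let $f\colon X\to X$ be a mapping. Assume that $\emptyset\neq Y\subset X$ is such that $f(Y)\subset Y$, that $x\in c_{\mathcal{B}}(f_{\mid Y})$, and that $$f(Y\cap B(x))\subset B(f(x))\quad\text{for all } B\in\mathcal{B}.$$ Then $f(x)\in c_{\mathcal{B}}(f_{\mid Y})$. Moreover, if $c_{\mathcal{B}}(f_{\mid Y})$ is a singleton, then $x$ is a fixed point of $f$, i.e. $f(x)=x$.
   Context: A primitive uniform space is a pair $(X,\mathcal{B})$, where $X$ is a nonempty set and $\mathcal{B}$ is a family of subsets of $X\times X$ such that $X\times X\in\mathcal{B}$ (no other condition is imposed on $\mathcal{B}$). For $B\in\mathcal{B}$ and $x\in X$ write $B(x)=\{y\in X:(x,y)\in B\}$. A (multivalued) mapping $F\colon Y\to 2^{Y}$ assigns to each $y\in Y$ a nonempty subset $F(y)\subset Y$; $F(A)=\bigcup_{a\in A}F(a)$ and $F^{n}(Y)$ denotes the $n$-th iterated image of $Y$ under $F$, $n\in\mathbb{N}$. A single-valued mapping $f$ is identified with $y\mapsto\{f(y)\}$. Let $\emptyset\neq Y\subset X$ and let $F\colon Y\to 2^{Y}$ be a mapping. A point $x\in X$ is a central point for $F$ if $$\bigcap\{B\in\mathcal{B}: F^{n}(Y)\subset B(z)\text{ for some } n\in\mathbb{N}\text{ and some } z\in X\}=\bigcap\{B\in\mathcal{B}: F^{n}(Y)\subset B(x)\text{ for some } n\in\mathbb{N}\}.$$ The centre $c_{\mathcal{B}}(F)$ of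 $F$ is the set of all central points for $F$. Here $f_{\mid Y}$ is the restriction of $f$ to $Y$, regarded as a mapping of $Y$ into $Y$. *)

theory Defs
  imports Main "HOL-Library.FuncSet"
begin

locale primitive_uniform_space =
  fixes X :: "'a set" and \<B> :: "('a \<times> 'a) set set"
  assumes nonempty: "X \<noteq> {}"
    and subsets: "\<And>B. B \<in> \<B> \<Longrightarrow> B \<subseteq> X \<times> X"
    and full: "X \<times> X \<in> \<B>"

text \<open>
  For a member B of the family, the set B(x) is written \<open>B `` {x}\<close>; since
  \<open>B \<subseteq> X \<times> X\<close>, it automatically consists of points of X.
\<close>

definition multivalued_self_map :: "'a set \<Rightarrow> ('a \<Rightarrow> 'a set) \<Rightarrow> bool" where
  "multivalued_self_map Y F \<longleftrightarrow> (\<forall>y\<in>Y. F y \<noteq> {} \<and> F y \<subseteq> Y)"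

definition multi_image :: "('a \<Rightarrow> 'a set) \<Rightarrow> 'a set \<Rightarrow> 'a set" where
  "multi_image F A = (\<Union>a\<in>A. F a)"

definition iterated_image :: "('a \<Rightarrow> 'a set) \<Rightarrow> nat \<Rightarrow> 'a set \<Rightarrow> 'a set" where
  "iterated_image F n A = (multi_image F ^^ n) A"

definition as_multivalued :: "('a \<Rightarrow> 'a) \<Rightarrow> 'a \<Rightarrow> 'a set" where
  "as_multivalued f = (\<lambda>y. {f y})"

text \<open>
  The parameter Y is the domain of F; values of F outside Y play no role when F maps Y into
  itself. The index n ranges over all natural numbers including 0; starting at 1 gives the same
  notion, because the iterated images of Y decrease (lemma \<open>iterated_image_decreasing\<close>).
  For \<open>Y \<subseteq> X\<close> and x in X both families below contain \<open>X \<times> X\<close>, so no empty intersection occurs.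
\<close>

definition central_point ::
  "'a set \<Rightarrow> ('a \<times> 'a) set set \<Rightarrow> 'a set \<Rightarrow> ('a \<Rightarrow> 'a set) \<Rightarrow> 'a \<Rightarrow> bool" where
  "central_point X \<B> Y F x \<longleftrightarrow> x \<in> X \<and>
     \<Inter> {B \<in> \<B>. \<exists>n. \<exists>z\<in>X. iterated_image F n Y \<subseteq> B `` {z}} =
     \<Inter> {B \<in> \<B>. \<exists>n. iterated_image F n Y \<subseteq> B `` {x}}"

definition centre ::
  "'a set \<Rightarrow> ('a \<times> 'a) set set \<Rightarrow> 'a set \<Rightarrow> ('a \<Rightarrow> 'a set) \<Rightarrow> 'a set" where
  "centre X \<B> Y F = {x. central_point X \<B> Y F x}"

lemma iterated_image_decreasing:
  assumes "multivalued_self_map Y F"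
  shows "iterated_image F (Suc n) Y \<subseteq> iterated_image F n Y"
proof (induction n)
  case 0
  show ?case
    using assms by (auto simp: iterated_image_def multi_image_def multivalued_self_map_def)
next
  case (Suc n)
  then show ?case
    unfolding iterated_image_def multi_image_def by auto
qed

lemma multivalued_self_map_restrict:
  assumes "f ` Y \<subseteq> Y"
  shows "multivalued_self_map Y (as_multivalued (restrict f Y))"
  using assms by (auto simp: multivalued_self_map_def as_multivalued_def)

end

theory Submission
  imports Defs
begin

text \<open>
  Attach to each point z the family of all members B of \<open>\<B>\<close> whose section B(z) contains some
  iterated image of Y. A point is central when the family attached to it already has the smallest
  possible intersection, namely that of the union of all these families; so centrality passes from
  x to any point of X whose family contains that of x (lemma \<open>central_point_mono\<close>). The
  hypothesis on f at x ensures that one more application of f carries an iterated image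
  inside B(x) to one inside B(f(x)), whence the family of x is contained in the family of f(x).
  Thus f(x) is central, and if there is only one central point it must be fixed.
\<close>

lemma iterated_image_subset:
  assumes "multivalued_self_map Y F"
  shows "iterated_image F n Y \<subseteq> Y"
proof (induction n)
  case 0
  show ?case by (simp add: iterated_image_def)
next
  case (Suc n)
  then show ?case using iterated_image_decreasing[OF assms, of n] by blast
qed

lemma iterated_image_Suc:
  "iterated_image F (Suc n) A = multi_image F (iterated_image F n A)"
  by (simp add: iterated_image_def)

text \<open>
  Enlarging the family over which the second intersection in the definition of a central point is
  taken can only shrink that intersection, but never below the first one, which does not depend on
  the point.
\<close>

lemma central_point_mono:
  assumes x: "central_point X \<B> Y F x" and y: "y \<in> X"
    and larger: "\<And>B n. \<lbrakk>B \<in> \<B>; iterated_image F n Y \<subseteq> B `` {x}\<rbrakk>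
      \<Longrightarrow> \<exists>m. iterated_image F m Y \<subseteq> B `` {y}"
  shows "central_point X \<B> Y F y"
proof -
  let ?N = "\<lambda>z. {B \<in> \<B>. \<exists>n. iterated_image F n Y \<subseteq> B `` {z}}"
  let ?U = "{B \<in> \<B>. \<exists>n. \<exists>z\<in>X. iterated_image F n Y \<subseteq> B `` {z}}"
  have "?N x \<subseteq> ?N y" using larger by blast
  then have "\<Inter> (?N y) \<subseteq> \<Inter> (?N x)" by (rule Inter_anti_mono)
  also have "\<dots> = \<Inter> ?U" using x by (simp add: central_point_def)
  finally have "\<Inter> (?N y) \<subseteq> \<Inter> ?U" .
  moreover have "\<Inter> ?U \<subseteq> \<Inter> (?N y)" using y by (intro Inter_anti_mono) blast
  ultimately show ?thesis using y by (simp add: central_point_def)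
qed

theorem theorem4:
  fixes X Y :: "'a set" and \<B> :: "('a \<times> 'a) set set" and f :: "'a \<Rightarrow> 'a" and x :: 'a
  assumes "primitive_uniform_space X \<B>"
    and "f \<in> X \<rightarrow> X"
    and "Y \<noteq> {}" and "Y \<subseteq> X" and "f ` Y \<subseteq> Y"
    and "x \<in> centre X \<B> Y (as_multivalued (restrict f Y))"
    and "\<And>B. B \<in> \<B> \<Longrightarrow> f ` (Y \<inter> B `` {x}) \<subseteq> B `` {f x}"
  shows "f x \<in> centre X \<B> Y (as_multivalued (restrict f Y)) \<and>
    (is_singleton (centre X \<B> Y (as_multivalued (restrict f Y))) \<longrightarrow> f x = x)"
proof -
  let ?F = "as_multivalued (restrict f Y)"
  have x: "central_point X \<B> Y ?F x" using assms(6) by (simp add: centre_def)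
  have "central_point X \<B> Y ?F (f x)"
  proof (rule central_point_mono[OF x])
    show "f x \<in> X" using x assms(2) by (auto simp: central_point_def)
  next
    fix B n
    assume B: "B \<in> \<B>" and sub: "iterated_image ?F n Y \<subseteq> B `` {x}"
    have in_Y: "iterated_image ?F n Y \<subseteq> Y"
      by (rule iterated_image_subset[OF multivalued_self_map_restrict[OF assms(5)]])
    then have "iterated_image ?F (Suc n) Y = f ` iterated_image ?F n Y"
      by (auto simp: iterated_image_Suc multi_image_def as_multivalued_def subset_iff)
    also have "\<dots> \<subseteq> f ` (Y \<inter> B `` {x})" using in_Y sub by blast
    also have "\<dots> \<subseteq> B `` {f x}" by (rule assms(7)[OF B])
    finally show "\<exists>m. iterated_image ?F m Y \<subseteq> B `` {f x}" by blast
  qed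
  then have fx: "f x \<in> centre X \<B> Y ?F" by (simp add: centre_def)
  with assms(6) show ?thesis by (auto simp: is_singleton_def)
qed

end
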